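(* Let $\mathcal{G}$ be the graph on the vertex set $\{1,2,3,4,5,6\}$ with edges $(1,2),(2,3),(1,4),(2,5),(3,6),(4,5),(5,6),(4,6)$. Then the MLE in the Gaussian graphical model on $\mathcal{G}$ exists with probability one for $n=3$ observations.
   Context: For an undirected graph $G=([m],E)$, where $E$ is taken to contain all self-loops $(i,i)$ in addition to the listed edges, the (mean zero) Gaussian graphical model on $G$ is the family of distributions $\mathcal{N}(0,\Sigma)$ on $\mathbb{R}^m$ with $\Sigma$ symmetric positive definite and $(\Sigma^{-1})_{ij}=0$ for all $(i,j)\notin E$. Let $\mathcal{K}_G$ be the set of symmetric positive definite $m\times m$ matrices $K$ with $K_{ij}=0$ for all $(i,j)\notin E$. Given observations $X_1,\dots,X_n\in\mathbb{R}^m$, the sample covariance matrix is $S=\frac1n\sum_{k=1}^n X_kX_k^T$ (the mean is known to be zero). The maximum likelihood estimator (MLE) exists for these observations if the log-likelihood $K\mapsto \log\det K-\operatorname{tr}(SK)$ attains its maximum over $\mathcal{K}_G$; by a theorem of Dempster this holds if and only if there is a positive definite matrix $\hat\Sigma$ with $\hat\Sigma_{ij}=S_{ij}$ for all $(i,j)\in E$ (diagonal entries included). "The MLE exists with probability one for $n$ observations" means that it exists almost surely when $X_1,\dots,X_n$ are independent draws from a distribution $\mathcal{N}(0,\Sigma)$ in the model. *)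

theory Defs
  imports "HOL-Probability.Probability"
begin

(* A listed pair (i, j) stands for the undirected edge {i, j}. *)
definition undirected_with_loops :: "('m \<times> 'm) set \<Rightarrow> ('m \<times> 'm) set" where
  "undirected_with_loops L = L \<union> L\<inverse> \<union> Id"

definition sym_pos_def :: "real^'m^'m \<Rightarrow> bool" where
  "sym_pos_def A \<longleftrightarrow> transpose A = A \<and> (\<forall>x. x \<noteq> 0 \<longrightarrow> 0 < x \<bullet> (A *v x))"

definition concentration_matrices :: "('m \<times> 'm) set \<Rightarrow> (real^'m^'m) set" where
  "concentration_matrices E = {K. sym_pos_def K \<and> (\<forall>i j. (i, j) \<notin> E \<longrightarrow> K $ i $ j = 0)}"

(* The model is the family of N(0, Sigma) with Sigma in this set. *)
definition model_covariances :: "('m \<times> 'm) set \<Rightarrow> (real^'m^'m) set" where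
  "model_covariances E =
     {\<Sigma>. sym_pos_def \<Sigma> \<and> (\<forall>i j. (i, j) \<notin> E \<longrightarrow> matrix_inv \<Sigma> $ i $ j = 0)}"

(* Lebesgue density of N(0, Sigma); used only for positive definite Sigma. *)
definition mvn_density :: "real^'m^'m \<Rightarrow> real^'m \<Rightarrow> real" where
  "mvn_density \<Sigma> x =
     exp (- (x \<bullet> (matrix_inv \<Sigma> *v x)) / 2) / sqrt ((2 * pi) ^ CARD('m) * det \<Sigma>)"

(* The mean is known to be zero, so the observations are not centred. *)
definition sample_cov :: "nat \<Rightarrow> (nat \<Rightarrow> real^'m) \<Rightarrow> real^'m^'m" where
  "sample_cov n X = (\<chi> i j. (\<Sum>k=1..n. X k $ i * X k $ j) / real n)"

definition log_likelihood :: "real^'m^'m \<Rightarrow> real^'m^'m \<Rightarrow> real" where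
  "log_likelihood S K = ln (det K) - trace (S ** K)"

definition mle_exists :: "('m \<times> 'm) set \<Rightarrow> real^'m^'m \<Rightarrow> bool" where
  "mle_exists E S \<longleftrightarrow>
     (\<exists>K\<in>concentration_matrices E. \<forall>K'\<in>concentration_matrices E.
        log_likelihood S K' \<le> log_likelihood S K)"

(* The numeral type 6 is the integers modulo 6, so its elements are exactly
   1, 2, 3, 4, 5, 6 (the last being equal to 0). *)
definition graph_G :: "(6 \<times> 6) set" where
  "graph_G = undirected_with_loops
     {(1, 2), (2, 3), (1, 4), (2, 5), (3, 6), (4, 5), (5, 6), (4, 6)}"

lemma UNIV_6: "(UNIV :: 6 set) = {1, 2, 3, 4, 5, 6}"
proof -
  have "card {1, 2, 3, 4, 5, 6 :: 6} = CARD(6)"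
    by simp
  then show ?thesis
    by (metis card_subset_eq finite subset_UNIV)
qed

end

(* The log-likelihood attains its maximum as soon as tr(S K) > 0 for every nonzero positive
   semidefinite K supported on the graph, by compactness of the superlevel sets. If tr(S K) = 0,
   then K annihilates all three observations. Writing y_i in R^3 for the vector of i-th coordinates
   of the observations, this says that sum_j K_ij y_j = 0 for every row i. Rows 1 and 3 involve only
   y_1, y_2, y_4 and y_2, y_3, y_6. When these triples are independent both rows vanish, hence so do
   the corresponding columns; row 2 is then a relation between y_2 and y_5, and rows 4, 5, 6 are
   relations between y_4, y_5, y_6. So K = 0 whenever four 3x3 minors of the data are nonzero. Almost
   sure nonvanishing follows by adding one observation at a time: each minor is linear in the newest
   observation, with a coefficient vector that depends on the earlier ones and is almost surely
   nonzero. *)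
theory Submission
  imports Defs "HOL-Real_Asymp.Real_Asymp"
begin

section \<open>Positive semidefinite matrices\<close>

text \<open>Relaxing definite to semidefinite turns the open-ended set of concentration matrices
  into a closed cone, on which compactness arguments are available.\<close>

definition psd_matrices :: "('m::finite \<times> 'm) set \<Rightarrow> (real^'m^'m) set" where
  "psd_matrices E =
     {K. transpose K = K \<and> (\<forall>x. 0 \<le> x \<bullet> (K *v x)) \<and> (\<forall>i j. (i, j) \<notin> E \<longrightarrow> K $ i $ j = 0)}"

lemma psd_matricesD:
  assumes "K \<in> psd_matrices E"
  shows "transpose K = K" "0 \<le> x \<bullet> (K *v x)" "(i, j) \<notin> E \<Longrightarrow> K $ i $ j = 0"
    "K $ i $ j = K $ j $ i"
proof -
  show *: "transpose K = K" "0 \<le> x \<bullet> (K *v x)" "(i, j) \<notin> E \<Longrightarrow> K $ i $ j = 0"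
    using assms by (auto simp: psd_matrices_def)
  show "K $ i $ j = K $ j $ i"
    using arg_cong[OF *(1), of "\<lambda>A. A $ i $ j"] by (simp add: transpose_def)
qed

lemma concentration_subset_psd:
  fixes E :: "('m::finite \<times> 'm) set"
  shows "concentration_matrices E \<subseteq> psd_matrices E"
proof
  fix K :: "real^'m^'m" assume K: "K \<in> concentration_matrices E"
  have "0 \<le> x \<bullet> (K *v x)" for x
    using K by (cases "x = 0") (auto simp: concentration_matrices_def sym_pos_def_def less_imp_le)
  with K show "K \<in> psd_matrices E"
    by (auto simp: concentration_matrices_def sym_pos_def_def psd_matrices_def)
qed

text \<open>If y = K x were nonzero, the form at x + t y would equal t (2 |y|^2 + t b) with b = y .
  K y, which is negative for small negative t.\<close>

lemma psd_quadratic_form_eq_0: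
  fixes K :: "real^'m::finite^'m"
  assumes "K \<in> psd_matrices E" and "x \<bullet> (K *v x) = 0"
  shows "K *v x = 0"
proof (rule ccontr)
  define y where "y = K *v x"
  assume "K *v x \<noteq> 0"
  then have y: "y \<bullet> y > 0" by (simp add: y_def)
  have sym: "x \<bullet> (K *v y) = y \<bullet> y"
    by (metis dot_lmul_matrix psd_matricesD(1)[OF assms(1)] transpose_matrix_vector y_def)
  define b where "b = y \<bullet> (K *v y)"
  have b: "b \<ge> 0" unfolding b_def by (rule psd_matricesD(2)[OF assms(1)])
  have ge: "0 \<le> t * (2 * (y \<bullet> y) + t * b)" for t
  proof -
    have "0 \<le> (x + t *\<^sub>R y) \<bullet> (K *v (x + t *\<^sub>R y))"
      by (rule psd_matricesD(2)[OF assms(1)])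
    also have "\<dots> = x \<bullet> (K *v x) + t * (y \<bullet> (K *v x)) + t * (x \<bullet> (K *v y)) + t * t * b"
      by (simp add: matrix_vector_right_distrib matrix_vector_mult_scaleR inner_add_left
          inner_add_right b_def algebra_simps)
    also have "\<dots> = t * (2 * (y \<bullet> y) + t * b)"
      using assms(2) sym by (simp add: algebra_simps flip: y_def)
    finally show ?thesis .
  qed
  \<comment> \<open>This t is negative yet satisfies t b \<ge> -|y|^2, because b/(b+1) \<le> 1; the
    summand 1 keeps the denominator positive when b = 0.\<close>
  define t where "t = - (y \<bullet> y) / (b + 1)"
  have "b / (b + 1) \<le> 1" using b by simp
  then have "(y \<bullet> y) * (b / (b + 1)) \<le> (y \<bullet> y) * 1" using y by (intro mult_left_mono) auto
  moreover have "t * b = - ((y \<bullet> y) * (b / (b + 1)))" by (simp add: t_def)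
  ultimately have "2 * (y \<bullet> y) + t * b > 0" using y by linarith
  moreover have "t < 0" using y b by (simp add: t_def divide_neg_pos)
  ultimately show False using ge[of t] mult_neg_pos[of t] by (metis not_le)
qed

lemma trace_psd_nonneg:
  assumes "K \<in> psd_matrices E"
  shows "0 \<le> trace K"
  unfolding trace_def
proof (rule sum_nonneg)
  fix i
  have "axis i 1 \<bullet> (K *v axis i 1) = K $ i $ i"
    by (simp add: matrix_vector_mult_basis inner_axis' column_def)
  then show "0 \<le> K $ i $ i" using psd_matricesD(2)[OF assms, of "axis i 1"] by simp
qed

text \<open>Evaluating the form at e_i + e_j and e_i - e_j bounds 2 |K_ij| by K_ii + K_jj. On the
  cone the trace can therefore serve as a norm.\<close>

lemma psd_entry_le_trace:
  assumes "K \<in> psd_matrices E"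
  shows "\<bar>K $ i $ j\<bar> \<le> trace K"
proof -
  have q: "axis k 1 \<bullet> (K *v axis l 1) = K $ k $ l" for k l
    by (simp add: matrix_vector_mult_basis inner_axis' column_def)
  have d: "0 \<le> K $ k $ k" for k
    using psd_matricesD(2)[OF assms, of "axis k 1"] by (simp add: q)
  have dle: "K $ k $ k \<le> trace K" for k
    unfolding trace_def by (rule member_le_sum) (auto simp: d)
  have "0 \<le> (axis i 1 + axis j 1) \<bullet> (K *v (axis i 1 + axis j 1))"
    "0 \<le> (axis i 1 - axis j 1) \<bullet> (K *v (axis i 1 - axis j 1))"
    by (rule psd_matricesD(2)[OF assms])+
  then have "0 \<le> K $ i $ i + K $ j $ j + 2 * K $ i $ j" "0 \<le> K $ i $ i + K $ j $ j - 2 * K $ i $ j"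
    using psd_matricesD(4)[OF assms, of i j]
    by (simp_all add: matrix_vector_right_distrib matrix_vector_mult_diff_distrib inner_add_left
        inner_add_right inner_diff_left inner_diff_right q)
  then show ?thesis using dle[of i] dle[of j] by (simp add: abs_le_iff)
qed

lemma psd_trace_eq_0:
  assumes "K \<in> psd_matrices E" and "trace K = 0"
  shows "K = 0"
  using psd_entry_le_trace[OF assms(1)] assms(2) by (simp add: vec_eq_iff)

lemma psd_scaleR:
  assumes "K \<in> psd_matrices E" and "0 \<le> c"
  shows "c *\<^sub>R K \<in> psd_matrices E"
  using assms psd_matricesD(2)[OF assms(1)]
  by (auto simp: psd_matrices_def transpose_def vec_eq_iff scaleR_matrix_vector_assoc[symmetric])

section \<open>Trace and determinant on the cone\<close>

lemma trace_scaleR: "trace (c *\<^sub>R A) = c * trace (A :: real^'m::finite^'m)"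
  by (simp add: trace_def sum_distrib_left)

lemma trace_mult_scaleR: "trace (S ** (c *\<^sub>R K)) = c * trace (S ** (K :: real^'m::finite^'m))"
  by (simp add: trace_def matrix_matrix_mult_def sum_distrib_left mult.left_commute)

lemma continuous_on_trace: "continuous_on A (trace :: real^'m::finite^'m \<Rightarrow> real)"
  unfolding trace_def by (intro continuous_intros)

lemma continuous_on_trace_mult: "continuous_on A (\<lambda>K. trace (S ** (K :: real^'m::finite^'m)))"
  unfolding trace_def matrix_matrix_mult_def by (simp, intro continuous_intros)

lemma continuous_on_det_matrix: "continuous_on A (det :: real^'m::finite^'m \<Rightarrow> real)"
  unfolding det_def by (intro continuous_intros)

text \<open>The Leibniz expansion has m! terms, each a product of m entries bounded by the trace.
  Polynomial growth suffices: log det is then at most logarithmic in the trace.\<close>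

lemma det_psd_le:
  fixes K :: "real^'m::finite^'m"
  assumes "K \<in> psd_matrices E"
  shows "det K \<le> fact CARD('m) * trace K ^ CARD('m)"
proof -
  have "\<bar>det K\<bar> \<le> (\<Sum>p | p permutes (UNIV::'m set). trace K ^ CARD('m))"
    unfolding det_def
  proof (rule sum_abs[THEN order_trans], rule sum_mono)
    fix p :: "'m \<Rightarrow> 'm"
    have "\<bar>of_int (sign p) * (\<Prod>i\<in>UNIV. K $ i $ p i)\<bar> = (\<Prod>i\<in>UNIV. \<bar>K $ i $ p i\<bar>)"
      by (simp add: abs_mult abs_prod sign_def)
    also have "\<dots> \<le> (\<Prod>i\<in>(UNIV::'m set). trace K)"
      by (intro prod_mono) (auto intro: psd_entry_le_trace[OF assms])
    finally show "\<bar>of_int (sign p) * (\<Prod>i\<in>UNIV. K $ i $ p i)\<bar> \<le> trace K ^ CARD('m)"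
      by simp
  qed
  also have "\<dots> = fact CARD('m) * trace K ^ CARD('m)"
    by (simp add: card_permutations[OF refl finite])
  finally show ?thesis by simp
qed

lemma sym_pos_def_det_nonzero:
  fixes K :: "real^'m::finite^'m"
  assumes "sym_pos_def K"
  shows "det K \<noteq> 0"
proof -
  have "x = 0" if "K *v x = 0" for x
    using assms that unfolding sym_pos_def_def by (metis inner_zero_right less_irrefl)
  then show ?thesis
    by (metis invertible_det_nz invertible_left_inverse matrix_left_invertible_ker)
qed

text \<open>The segment from the identity to K consists of positive definite matrices, so the
  determinant has no zero along it; it starts at 1 and keeps its sign by the intermediate value
  theorem.\<close>

lemma sym_pos_def_det_pos:
  fixes K :: "real^'m::finite^'m"
  assumes "sym_pos_def K"
  shows "0 < det K"
proof (rule ccontr)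
  let ?A = "\<lambda>t::real. (1 - t) *\<^sub>R mat 1 + t *\<^sub>R K"
  assume "\<not> 0 < det K"
  moreover have "continuous_on {0..1} (\<lambda>t. det (?A t))"
    by (rule continuous_on_compose2[OF continuous_on_det_matrix[of UNIV]])
       (auto intro!: continuous_intros)
  ultimately obtain t where t: "0 \<le> t" "t \<le> 1" "det (?A t) = 0"
    using IVT2'[of "\<lambda>t. det (?A t)" 1 0 0] by (auto simp: not_less)
  have "sym_pos_def (?A t)"
    unfolding sym_pos_def_def
  proof (intro conjI allI impI)
    show "transpose (?A t) = ?A t"
      using assms by (auto simp: sym_pos_def_def transpose_def vec_eq_iff mat_def)
    fix x :: "real^'m" assume x: "x \<noteq> 0"
    have "x \<bullet> (?A t *v x) = (1 - t) * (x \<bullet> x) + t * (x \<bullet> (K *v x))"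
      by (simp add: matrix_vector_mult_add_rdistrib scaleR_matrix_vector_assoc[symmetric]
          inner_add_right)
    moreover have "0 < x \<bullet> x" "0 < x \<bullet> (K *v x)"
      using x assms by (auto simp: sym_pos_def_def)
    ultimately show "0 < x \<bullet> (?A t *v x)"
      using t by (cases "t = 0") (auto intro!: add_nonneg_pos)
  qed
  then show False using sym_pos_def_det_nonzero t(3) by blast
qed

text \<open>Used to recognise a maximiser found in the closed cone as an admissible one: a zero of
  the form would be a kernel vector.\<close>

lemma psd_det_nonzero_imp_concentration:
  fixes K :: "real^'m::finite^'m"
  assumes "K \<in> psd_matrices E" and "det K \<noteq> 0"
  shows "K \<in> concentration_matrices E"
proof -
  have "0 < x \<bullet> (K *v x)" if "x \<noteq> 0" for x
  proof -
    have "K *v x \<noteq> 0"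
      using assms(2) that
      by (metis invertible_det_nz invertible_left_inverse matrix_left_invertible_ker)
    then show ?thesis
      using psd_quadratic_form_eq_0[OF assms(1)] psd_matricesD(2)[OF assms(1), of x]
      by (metis order_le_less)
  qed
  then show ?thesis
    using assms by (auto simp: concentration_matrices_def sym_pos_def_def psd_matrices_def)
qed

section \<open>Closedness of the cone and compactness of its trace-bounded parts\<close>

lemma closed_psd_matrices:
  fixes E :: "('m::finite \<times> 'm) set"
  shows "closed (psd_matrices E)"
proof -
  have "psd_matrices E = {K. \<forall>i j. K $ j $ i = K $ i $ j} \<inter> {K. \<forall>x. 0 \<le> x \<bullet> (K *v x)}
      \<inter> {K. \<forall>i j. (i, j) \<notin> E \<longrightarrow> K $ i $ j = 0}"
    by (auto simp: psd_matrices_def transpose_def vec_eq_iff)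
  moreover have "closed {K :: real^'m^'m. \<forall>i j. K $ j $ i = K $ i $ j}"
    by (intro closed_Collect_all closed_Collect_eq continuous_intros)
  moreover have "closed {K :: real^'m^'m. \<forall>x. 0 \<le> x \<bullet> (K *v x)}"
    unfolding inner_vec_def matrix_vector_mult_def
    by (simp, intro closed_Collect_all closed_Collect_le continuous_intros)
  moreover have "closed {K :: real^'m^'m. \<forall>i j. (i, j) \<notin> E \<longrightarrow> K $ i $ j = 0}"
    by (intro closed_Collect_all closed_Collect_imp closed_Collect_eq continuous_intros) auto
  ultimately show ?thesis by (simp add: closed_Int)
qed

lemma compact_psd_trace_le:
  fixes E :: "('m::finite \<times> 'm) set"
  shows "compact {K \<in> psd_matrices E. trace K \<le> T}"
proof (rule compact_eq_bounded_closed[THEN iffD2, OF conjI])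
  have "norm K \<le> (\<Sum>i\<in>(UNIV::'m set). \<Sum>j\<in>(UNIV::'m set). T)"
    if K: "K \<in> psd_matrices E" "trace K \<le> T" for K :: "real^'m^'m"
  proof -
    have "norm K \<le> (\<Sum>i\<in>UNIV. norm (K $ i))"
      by (simp add: norm_vec_def L2_set_le_sum)
    also have "\<dots> \<le> (\<Sum>i\<in>UNIV. \<Sum>j\<in>UNIV. \<bar>K $ i $ j\<bar>)"
      by (intro sum_mono norm_le_l1_cart)
    also have "\<dots> \<le> (\<Sum>i\<in>(UNIV::'m set). \<Sum>j\<in>(UNIV::'m set). T)"
      by (intro sum_mono order_trans[OF psd_entry_le_trace[OF K(1)] K(2)])
    finally show ?thesis .
  qed
  then show "bounded {K \<in> psd_matrices E. trace K \<le> T}"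
    unfolding bounded_iff by blast
  have "closed (psd_matrices E \<inter> {K. trace K \<le> T})"
    by (intro closed_Int closed_psd_matrices closed_Collect_le continuous_on_trace continuous_intros)
  then show "closed {K \<in> psd_matrices E. trace K \<le> T}" by (simp add: Int_def)
qed

section \<open>Existence of the maximum likelihood estimator\<close>

lemma mat_1_psd:
  assumes "Id \<subseteq> E"
  shows "mat 1 \<in> psd_matrices E"
  unfolding psd_matrices_def matrix_vector_mul_lid
  using assms by (auto simp: transpose_mat) (auto simp: mat_def)

text \<open>Both sides of the bound are homogeneous of degree one, so it suffices to compare them on
  the compact slice of trace 1, where the positive continuous function tr(S K) has a positive
  minimum c.\<close>

lemma trace_mult_psd_ge:
  fixes S :: "real^'m::finite^'m"
  assumes "Id \<subseteq> E"
    and pos: "\<And>K. K \<in> psd_matrices E \<Longrightarrow> K \<noteq> 0 \<Longrightarrow> 0 < trace (S ** K)"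
  obtains c where "0 < c" "\<And>K. K \<in> psd_matrices E \<Longrightarrow> c * trace K \<le> trace (S ** K)"
proof -
  let ?B = "{K \<in> psd_matrices E. trace K \<le> 1} \<inter> {K. trace K = 1}"
  have "compact ?B"
    by (intro compact_Int_closed compact_psd_trace_le closed_Collect_eq continuous_on_trace
        continuous_intros)
  have scale: "(1 / trace K) *\<^sub>R K \<in> ?B" if "K \<in> psd_matrices E" "trace K \<noteq> 0" for K
    using that psd_scaleR[OF that(1), of "1 / trace K"] trace_psd_nonneg[OF that(1)]
    by (simp add: trace_scaleR)
  \<comment> \<open>The normalised identity shows that the slice is nonempty; it lies in the cone
    because all loops are in E.\<close>
  have "(1 / trace (mat 1 :: real^'m^'m)) *\<^sub>R (mat 1 :: real^'m^'m) \<in> ?B"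
    by (rule scale[OF mat_1_psd[OF assms(1)]]) (simp add: trace_def mat_def)
  then have "?B \<noteq> {}" by blast
  with \<open>compact ?B\<close> obtain K0 where K0: "K0 \<in> ?B" "\<And>K. K \<in> ?B \<Longrightarrow> trace (S ** K0) \<le> trace (S ** K)"
    using continuous_attains_inf[of ?B "\<lambda>K. trace (S ** K)", OF _ _ continuous_on_trace_mult]
    by blast
  have "K0 \<noteq> 0" using K0(1) by (auto simp: trace_def)
  show thesis
  proof
    show "0 < trace (S ** K0)" using pos K0(1) \<open>K0 \<noteq> 0\<close> by blast
    fix K assume K: "K \<in> psd_matrices E"
    show "trace (S ** K0) * trace K \<le> trace (S ** K)"
    proof (cases "trace K = 0")
      case True
      then show ?thesis
        using psd_trace_eq_0[OF K] by (simp add: trace_def matrix_matrix_mult_def)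
    next
      case False
      then have "0 < trace K" using trace_psd_nonneg[OF K] by simp
      moreover have "trace (S ** K0) \<le> trace (S ** K) / trace K"
        using K0(2)[OF scale[OF K False]] by (simp add: trace_mult_scaleR)
      ultimately show ?thesis by (simp add: field_simps)
    qed
  qed
qed

text \<open>The hypothesis makes the linear term of the log-likelihood dominate its logarithmic term, so
  all superlevel sets are compact.\<close>

lemma mle_existsI:
  fixes S :: "real^'m::finite^'m"
  assumes Id: "Id \<subseteq> E"
    and pos: "\<And>K. K \<in> psd_matrices E \<Longrightarrow> K \<noteq> 0 \<Longrightarrow> 0 < trace (S ** K)"
  shows "mle_exists E S"
proof -
  let ?m = "CARD('m)"
  obtain c where c: "0 < c" "\<And>K. K \<in> psd_matrices E \<Longrightarrow> c * trace K \<le> trace (S ** K)"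
    using trace_mult_psd_ge[OF assms] by blast
  \<comment> \<open>The value at the identity is the baseline: a matrix below this level cannot
    compete.\<close>
  define L where "L = log_likelihood S (mat 1)"
  have L: "L = - trace (S ** mat 1)" by (simp add: L_def log_likelihood_def)
  have nonneg: "0 \<le> trace (S ** K)" if "K \<in> psd_matrices E" for K
    using c(1) c(2)[OF that] trace_psd_nonneg[OF that] by (meson mult_nonneg_nonneg less_imp_le order_trans)
  have "((\<lambda>t. (ln (fact ?m) + real ?m * ln t - L) / t) \<longlongrightarrow> 0) at_top"
    by real_asymp
  then have "\<forall>\<^sub>F t in at_top. (ln (fact ?m) + real ?m * ln t - L) / t < c"
    using c(1) by (rule order_tendstoD)
  then obtain T0 where T0: "\<And>t. t \<ge> T0 \<Longrightarrow> (ln (fact ?m) + real ?m * ln t - L) / t < c"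
    by (auto simp: eventually_at_top_linorder)
  \<comment> \<open>Beyond \<open>T0\<close> the linear term wins, the bound 1 makes t positive so
    that the quotient can be cleared, and the last entry places the identity itself in
    \<open>?W\<close>.\<close>
  define T where "T = max (max T0 1) (trace (mat 1 :: real^'m^'m))"
  have T: "ln (fact ?m) + real ?m * ln t - c * t < L" if "t \<ge> T" for t
    using T0[of t] that by (simp add: T_def field_simps)
  \<comment> \<open>A compact set containing the superlevel set at L. The condition on det follows
    from the likelihood bound since tr(S K) \<ge> 0; it is closed, and it keeps det away from 0 so
    that the logarithm is continuous.\<close>
  let ?W = "{K \<in> psd_matrices E. trace K \<le> T} \<inter> {K. exp L \<le> det K}"
  have superlevel: "K \<in> ?W" if K: "K \<in> concentration_matrices E" "L \<le> log_likelihood S K" for K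
  proof -
    have psd: "K \<in> psd_matrices E" using K(1) concentration_subset_psd by blast
    have det: "0 < det K"
      using K(1) sym_pos_def_det_pos by (auto simp: concentration_matrices_def)
    have "L \<le> ln (det K)" using K(2) nonneg[OF psd] by (simp add: log_likelihood_def)
    then have "exp L \<le> det K" using det by (simp add: ln_ge_iff)
    moreover have "trace K \<le> T"
    proof (rule ccontr)
      assume "\<not> trace K \<le> T"
      then have t: "T \<le> trace K" "0 < trace K" by (auto simp: T_def)
      have "ln (det K) \<le> ln (fact ?m * trace K ^ ?m)"
        using det_psd_le[OF psd] det by simp
      also have "\<dots> = ln (fact ?m) + real ?m * ln (trace K)"
        using t by (simp add: ln_mult ln_realpow)
      finally show False
        using T[OF t(1)] c(2)[OF psd] K(2) by (simp add: log_likelihood_def)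
    qed
    ultimately show ?thesis using psd by blast
  qed
  have "mat 1 \<in> ?W"
    using mat_1_psd[OF Id] nonneg[OF mat_1_psd[OF Id]] by (auto simp: T_def L)
  then have "?W \<noteq> {}" by blast
  moreover have "compact ?W"
    by (intro compact_Int_closed compact_psd_trace_le closed_Collect_le continuous_on_det_matrix
        continuous_intros)
  moreover have "det K \<noteq> 0" if "K \<in> ?W" for K
    using that by (auto simp: not_le)
  then have "continuous_on ?W (log_likelihood S)"
    unfolding log_likelihood_def
    by (intro continuous_intros continuous_on_det_matrix continuous_on_trace_mult) auto
  ultimately obtain K0 where K0: "K0 \<in> ?W"
    "\<And>K. K \<in> ?W \<Longrightarrow> log_likelihood S K \<le> log_likelihood S K0"
    using continuous_attains_sup[of ?W "log_likelihood S"] by blast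
  have "det K0 \<noteq> 0" using K0(1) by (auto simp: not_le)
  then have "K0 \<in> concentration_matrices E"
    using K0(1) psd_det_nonzero_imp_concentration by blast
  moreover have "log_likelihood S K \<le> log_likelihood S K0" if "K \<in> concentration_matrices E" for K
  proof (cases "L \<le> log_likelihood S K")
    case True
    then show ?thesis using K0(2) superlevel that by blast
  next
    \<comment> \<open>Below the baseline, K is already beaten by the identity, which belongs to
      \<open>?W\<close>.\<close>
    case False
    then show ?thesis using K0(2)[OF \<open>mat 1 \<in> ?W\<close>] by (simp add: L_def)
  qed
  ultimately show ?thesis unfolding mle_exists_def by blast
qed

text \<open>This is tr(x x^T K) = x^T K x summed over the observations; it makes tr(S K) a sum of
  nonnegative terms when K is positive semidefinite.\<close>

lemma trace_sample_cov_mult: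
  "trace (sample_cov n X ** K) = (\<Sum>k=1..n. X k \<bullet> (K *v X k)) / real n"
proof -
  have "trace (sample_cov n X ** K) =
      (\<Sum>i\<in>UNIV. \<Sum>j\<in>UNIV. \<Sum>k=1..n. X k $ i * X k $ j * K $ j $ i) / real n"
    by (simp add: trace_def matrix_matrix_mult_def sample_cov_def sum_divide_distrib
        sum_distrib_right)
  also have "(\<Sum>i\<in>UNIV. \<Sum>j\<in>UNIV. \<Sum>k=1..n. X k $ i * X k $ j * K $ j $ i) =
      (\<Sum>j\<in>UNIV. \<Sum>i\<in>UNIV. \<Sum>k=1..n. X k $ i * X k $ j * K $ j $ i)"
    by (rule sum.swap)
  also have "\<dots> = (\<Sum>j\<in>UNIV. \<Sum>k=1..n. \<Sum>i\<in>UNIV. X k $ i * X k $ j * K $ j $ i)"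
    by (rule sum.cong[OF refl], rule sum.swap)
  also have "\<dots> = (\<Sum>k=1..n. \<Sum>j\<in>UNIV. \<Sum>i\<in>UNIV. X k $ i * X k $ j * K $ j $ i)"
    by (rule sum.swap)
  also have "\<dots> = (\<Sum>k=1..n. X k \<bullet> (K *v X k))"
    by (simp add: inner_vec_def matrix_vector_mult_def sum_distrib_left mult_ac)
  finally show ?thesis .
qed

section \<open>The graph\<close>

text \<open>The determinant with observations 1, 2, 3 as rows and coordinates a, b, c as columns,
  expanded along the third row so that its linearity in the newest observation is visible.\<close>

definition det3 :: "(nat \<Rightarrow> real^'m) \<Rightarrow> 'm \<Rightarrow> 'm \<Rightarrow> 'm \<Rightarrow> real" where
  "det3 X a b c =
     (X 1 $ b * X 2 $ c - X 1 $ c * X 2 $ b) * X 3 $ a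
     + (X 1 $ c * X 2 $ a - X 1 $ a * X 2 $ c) * X 3 $ b
     + (X 1 $ a * X 2 $ b - X 1 $ b * X 2 $ a) * X 3 $ c"

lemma det3_rotate: "det3 X b c a = det3 X a b c"
  by (simp add: det3_def)

text \<open>Cramer's rule gives p = 0; the other two coefficients follow by rotating the columns
  cyclically.\<close>

lemma det3_nonzero_imp_independent:
  assumes rel: "\<And>k. k \<in> {1..3} \<Longrightarrow> p * X k $ a + q * X k $ b + r * X k $ c = 0"
    and det: "det3 X a b c \<noteq> 0"
  shows "p = 0" "q = 0" "r = 0"
proof -
  have first: "p = 0"
    if "\<And>k. k \<in> {1..3} \<Longrightarrow> p * X k $ a + q * X k $ b + r * X k $ c = 0" "det3 X a b c \<noteq> 0"
    for p q r a b c
  proof -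
    let ?e = "\<lambda>k. p * X k $ a + q * X k $ b + r * X k $ c"
    \<comment> \<open>The multipliers are the cofactors of column a, so the contributions of q and r
      cancel.\<close>
    have "p * det3 X a b c = (X 2 $ b * X 3 $ c - X 2 $ c * X 3 $ b) * ?e 1
        + (X 3 $ b * X 1 $ c - X 3 $ c * X 1 $ b) * ?e 2
        + (X 1 $ b * X 2 $ c - X 1 $ c * X 2 $ b) * ?e 3"
      by (simp add: det3_def algebra_simps)
    also have "\<dots> = 0" using that(1)[of 1] that(1)[of 2] that(1)[of 3] by simp
    finally show "p = 0" using that(2) by simp
  qed
  show "p = 0" by (rule first[OF rel det])
  show "q = 0"
  proof (rule first)
    show "q * X k $ b + r * X k $ c + p * X k $ a = 0" if "k \<in> {1..3}" for k
      using rel[OF that] by linarith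
    show "det3 X b c a \<noteq> 0" using det by (metis det3_rotate)
  qed
  show "r = 0"
  proof (rule first)
    show "r * X k $ c + p * X k $ a + q * X k $ b = 0" if "k \<in> {1..3}" for k
      using rel[OF that] by linarith
    show "det3 X c a b \<noteq> 0" using det by (metis det3_rotate)
  qed
qed

lemma sum_UNIV_6: "(\<Sum>i\<in>UNIV. f i) = f 1 + f 2 + f 3 + f 4 + f 5 + f (6::6)"
  unfolding UNIV_6 by (simp add: add.assoc)

lemma graph_G_annihilator_eq_0:
  assumes K: "K \<in> psd_matrices graph_G"
    and ann: "\<And>k. k \<in> {1..3} \<Longrightarrow> K *v X k = 0"
    and det: "det3 X 1 2 4 \<noteq> 0" "det3 X 2 3 6 \<noteq> 0" "det3 X 2 5 6 \<noteq> 0" "det3 X 4 5 6 \<noteq> 0"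
  shows "K = 0"
proof -
  note sym = psd_matricesD(4)[OF K]
  \<comment> \<open>These are the seven non-edges among the fifteen pairs of vertices.\<close>
  have z: "K $ 1 $ 3 = 0" "K $ 1 $ 5 = 0" "K $ 1 $ 6 = 0" "K $ 2 $ 4 = 0" "K $ 2 $ 6 = 0"
    "K $ 3 $ 4 = 0" "K $ 3 $ 5 = 0"
    by (rule psd_matricesD(3)[OF K]; simp add: graph_G_def undirected_with_loops_def)+
  have z': "K $ 3 $ 1 = 0" "K $ 5 $ 1 = 0" "K $ 6 $ 1 = 0" "K $ 4 $ 2 = 0" "K $ 6 $ 2 = 0"
    "K $ 4 $ 3 = 0" "K $ 5 $ 3 = 0"
    using z sym by metis+
  have row: "K $ i $ 1 * X k $ 1 + K $ i $ 2 * X k $ 2 + K $ i $ 3 * X k $ 3 + K $ i $ 4 * X k $ 4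
      + K $ i $ 5 * X k $ 5 + K $ i $ 6 * X k $ 6 = 0" if "k \<in> {1..3}" for i k
    using ann[OF that] by (simp add: vec_eq_iff matrix_vector_mult_def sum_UNIV_6)
  have "K $ 1 $ 1 * X k $ 1 + K $ 1 $ 2 * X k $ 2 + K $ 1 $ 4 * X k $ 4 = 0" if "k \<in> {1..3}" for k
    using row[OF that, of 1] z by simp
  note r1 = det3_nonzero_imp_independent[OF this det(1)]
  have "K $ 3 $ 2 * X k $ 2 + K $ 3 $ 3 * X k $ 3 + K $ 3 $ 6 * X k $ 6 = 0" if "k \<in> {1..3}" for k
    using row[OF that, of 3] z z' by simp
  note r3 = det3_nonzero_imp_independent[OF this det(2)]
  \<comment> \<open>By symmetry the vanishing of rows 1 and 3 removes columns 1 and 3 from the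
    remaining rows.\<close>
  have s: "K $ 2 $ 1 = 0" "K $ 4 $ 1 = 0" "K $ 2 $ 3 = 0" "K $ 6 $ 3 = 0"
    using r1 r3 sym by metis+
  \<comment> \<open>Only coordinates 2 and 5 remain in row 2; the zero coefficient at 6 completes a
    triple, so that a 3x3 minor applies.\<close>
  have "K $ 2 $ 2 * X k $ 2 + K $ 2 $ 5 * X k $ 5 + 0 * X k $ 6 = 0" if "k \<in> {1..3}" for k
    using row[OF that, of 2] z s by simp
  note r2 = det3_nonzero_imp_independent[OF this det(3)]
  have s5: "K $ 5 $ 2 = 0" using r2 sym by metis
  have "K $ i $ 4 * X k $ 4 + K $ i $ 5 * X k $ 5 + K $ i $ 6 * X k $ 6 = 0"
    if "i \<in> {4, 5, 6}" "k \<in> {1..3}" for i k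
    using row[OF that(2), of i] that(1) z' s s5 by auto
  note r = det3_nonzero_imp_independent[OF this det(4)]
  have "K $ i $ j = 0" for i j
  proof -
    have "i \<in> {1, 2, 3, 4, 5, 6}" "j \<in> {1, 2, 3, 4, 5, 6}" by (simp_all flip: UNIV_6)
    then show ?thesis using z z' s s5 r1 r2 r3 r by blast
  qed
  then show ?thesis by (simp add: vec_eq_iff)
qed

text \<open>A nonzero K fails to annihilate some observation, and that observation contributes a
  strictly positive term to tr(S K) while the others contribute nonnegative ones.\<close>

lemma mle_exists_graph_G:
  assumes "det3 X 1 2 4 \<noteq> 0" "det3 X 2 3 6 \<noteq> 0" "det3 X 2 5 6 \<noteq> 0" "det3 X 4 5 6 \<noteq> 0"
  shows "mle_exists graph_G (sample_cov 3 X)"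
proof (rule mle_existsI)
  show "Id \<subseteq> graph_G" by (auto simp: graph_G_def undirected_with_loops_def)
  fix K assume K: "K \<in> psd_matrices graph_G" "K \<noteq> 0"
  then obtain k where k: "k \<in> {1..3}" "K *v X k \<noteq> 0"
    using graph_G_annihilator_eq_0[OF K(1) _ assms] by blast
  then have "0 < X k \<bullet> (K *v X k)"
    using psd_quadratic_form_eq_0[OF K(1)] psd_matricesD(2)[OF K(1), of "X k"]
    by (metis order_le_less)
  then have "0 < (\<Sum>k=1..3. X k \<bullet> (K *v X k))"
    by (intro sum_pos2[OF _ k(1)] psd_matricesD(2)[OF K(1)]) auto
  then show "0 < trace (sample_cov 3 X ** K)" by (simp add: trace_sample_cov_mult)
qed

section \<open>Generic position of independent samples\<close>

lemma AE_lborel_not_orthogonal: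
  fixes w :: "'b::euclidean_space"
  assumes "w \<noteq> 0"
  shows "AE x in lborel. w \<bullet> x \<noteq> 0"
proof -
  \<comment> \<open>Negligibility concerns the completed Lebesgue measure; Borel measurability of
    the hyperplane transfers it to \<open>lborel\<close>.\<close>
  have "{x. w \<bullet> x = 0} \<in> null_sets lebesgue"
    using negligible_hyperplane[of w 0] assms by (simp add: negligible_iff_null_sets)
  moreover have "{x. w \<bullet> x = 0} \<in> sets lborel"
    by measurable
  ultimately have "{x. w \<bullet> x = 0} \<in> null_sets lborel"
    by (simp add: null_sets_completion_iff)
  then show ?thesis by (rule AE_I') auto
qed

text \<open>A Fubini argument: with the observations in J held fixed, w is a fixed vector, almost
  surely nonzero, and the independent \<open>X k\<close> has a density, hence misses the hyperplane
  orthogonal to w almost surely.\<close>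

lemma (in prob_space) AE_indep_not_orthogonal:
  fixes X :: "'i \<Rightarrow> 'a \<Rightarrow> 'b::euclidean_space"
  assumes indep: "indep_vars (\<lambda>_. borel) X I" and J: "J \<subseteq> I" "k \<in> I" "k \<notin> J"
    and dens: "distributed M lborel (X k) f"
    and w[measurable]: "w \<in> borel_measurable (PiM J (\<lambda>_. borel))"
    and ae: "AE \<omega> in M. w (restrict (\<lambda>i. X i \<omega>) J) \<noteq> 0"
  shows "AE \<omega> in M. w (restrict (\<lambda>i. X i \<omega>) J) \<bullet> X k \<omega> \<noteq> 0"
proof -
  let ?P = "PiM J (\<lambda>_. borel :: 'b measure)" and ?U = "\<lambda>\<omega>. restrict (\<lambda>i. X i \<omega>) J"
  \<comment> \<open>\<open>X k\<close> is wrapped as a family over the singleton index set, the form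
    in which independence of disjoint groups of variables is available.\<close>
  let ?Q = "PiM {k} (\<lambda>_. borel :: 'b measure)" and ?V = "\<lambda>\<omega>. restrict (\<lambda>i. X i \<omega>) {k}"
  have "indep_var ?P ?U ?Q ?V"
    using J by (intro indep_var_restrict[OF indep]) auto
  then have rv[measurable]: "?U \<in> measurable M ?P" "?V \<in> measurable M ?Q"
    and joint: "distr M ?P ?U \<Otimes>\<^sub>M distr M ?Q ?V = distr M (?P \<Otimes>\<^sub>M ?Q) (\<lambda>\<omega>. (?U \<omega>, ?V \<omega>))"
    by (auto simp: indep_var_distribution_eq)
  interpret U: prob_space "distr M ?P ?U" by (rule prob_space_distr) fact
  interpret V: prob_space "distr M ?Q ?V" by (rule prob_space_distr) fact
  interpret UV: pair_prob_space "distr M ?P ?U" "distr M ?Q ?V" ..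
  have [measurable]: "(\<lambda>g. g k) \<in> borel_measurable ?Q"
    by (rule measurable_component_singleton) simp
  have [measurable]: "X k \<in> borel_measurable M" "f \<in> borel_measurable lborel"
    using dens by (auto simp: distributed_def)
  have V: "AE g in distr M ?Q ?V. v \<bullet> g k \<noteq> 0" if "v \<noteq> 0" for v
  proof -
    have "AE x in distr M lborel (X k). v \<bullet> x \<noteq> 0"
      unfolding distributed_distr_eq_density[OF dens]
      using AE_lborel_not_orthogonal[OF that] by (auto simp: AE_density)
    then have "AE \<omega> in M. v \<bullet> X k \<omega> \<noteq> 0"
      by (subst (asm) AE_distr_iff) auto
    then show ?thesis by (subst AE_distr_iff) auto
  qed
  have "AE u in distr M ?P ?U. w u \<noteq> 0"
    using ae by (subst AE_distr_iff) auto
  then have "AE u in distr M ?P ?U. AE g in distr M ?Q ?V. w u \<bullet> g k \<noteq> 0"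
    by eventually_elim (rule V)
  then have "AE p in distr M ?P ?U \<Otimes>\<^sub>M distr M ?Q ?V. w (fst p) \<bullet> snd p k \<noteq> 0"
  proof (intro UV.AE_pair_measure)
    have "(\<lambda>p. w (fst p) \<bullet> snd p k)
        \<in> borel_measurable (distr M ?P ?U \<Otimes>\<^sub>M distr M ?Q ?V)"
      by measurable
    then show "{p \<in> space (distr M ?P ?U \<Otimes>\<^sub>M distr M ?Q ?V). w (fst p) \<bullet> snd p k \<noteq> 0}
        \<in> sets (distr M ?P ?U \<Otimes>\<^sub>M distr M ?Q ?V)"
      by measurable
  qed auto
  then show ?thesis
    unfolding joint by (subst (asm) AE_distr_iff) auto
qed

lemma (in prob_space) AE_det3_nonzero:
  fixes X :: "nat \<Rightarrow> 'a \<Rightarrow> real^'m::finite"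
  assumes indep: "indep_vars (\<lambda>_. borel) X {1..3}"
    and dens: "\<And>k. k \<in> {1..3} \<Longrightarrow> distributed M lborel (X k) (f k)"
    and ne: "a \<noteq> b" "a \<noteq> c" "b \<noteq> c"
  shows "AE \<omega> in M. det3 (\<lambda>k. X k \<omega>) a b c \<noteq> 0"
proof -
  note step = AE_indep_not_orthogonal[OF indep _ _ _ dens]
  have comp: "(\<lambda>g. g k $ i) \<in> borel_measurable (PiM J (\<lambda>_. borel))" if "k \<in> J"
    for k :: nat and J and i :: 'm
    by (rule measurable_compose[OF measurable_component_singleton[OF that]])
       (intro borel_measurable_continuous_onI continuous_intros)
  \<comment> \<open>Start of the induction: no earlier observations, and a constant coefficient
    vector.\<close>
  have "AE \<omega> in M. (axis a 1 :: real^'m) \<bullet> X 1 \<omega> \<noteq> 0"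
    by (rule step[where J = "{}" and w = "\<lambda>_. axis a 1"]) (auto simp: axis_eq_0_iff)
  then have 1: "AE \<omega> in M. X 1 \<omega> $ a \<noteq> 0" by (simp add: inner_axis')
  \<comment> \<open>Its inner product with the second observation is the 2x2 minor on columns a, b;
    its b-coordinate is the entry just shown to be nonzero.\<close>
  let ?w2 = "\<lambda>g. g 1 $ a *\<^sub>R axis b 1 - g 1 $ b *\<^sub>R axis a (1::real) :: real^'m"
  have "AE \<omega> in M. ?w2 (restrict (\<lambda>i. X i \<omega>) {1}) \<bullet> X 2 \<omega> \<noteq> 0"
  proof (rule step)
    show "AE \<omega> in M. ?w2 (restrict (\<lambda>i. X i \<omega>) {1}) \<noteq> 0"
      using 1
    proof eventually_elim
      case (elim \<omega>)
      then have "?w2 (restrict (\<lambda>i. X i \<omega>) {1}) $ b \<noteq> 0"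
        using ne by (simp add: axis_def)
      then show ?case by (metis zero_index)
    qed
  qed (auto intro!: comp borel_measurable_add borel_measurable_diff borel_measurable_times
      borel_measurable_scaleR)
  then have 2: "AE \<omega> in M. X 1 \<omega> $ a * X 2 \<omega> $ b - X 1 \<omega> $ b * X 2 \<omega> $ a \<noteq> 0"
    by (simp add: inner_diff_left inner_axis')
  \<comment> \<open>The cofactors of the third row, placed at a, b, c; the c-coordinate is the 2x2
    minor from the previous stage.\<close>
  let ?w3 = "\<lambda>g. (g 1 $ b * g 2 $ c - g 1 $ c * g 2 $ b) *\<^sub>R axis a 1
     + (g 1 $ c * g 2 $ a - g 1 $ a * g 2 $ c) *\<^sub>R axis b 1
     + (g 1 $ a * g 2 $ b - g 1 $ b * g 2 $ a) *\<^sub>R axis c (1::real) :: real^'m"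
  have "AE \<omega> in M. ?w3 (restrict (\<lambda>i. X i \<omega>) {1, 2}) \<bullet> X 3 \<omega> \<noteq> 0"
  proof (rule step)
    show "AE \<omega> in M. ?w3 (restrict (\<lambda>i. X i \<omega>) {1, 2}) \<noteq> 0"
      using 2
    proof eventually_elim
      case (elim \<omega>)
      then have "?w3 (restrict (\<lambda>i. X i \<omega>) {1, 2}) $ c \<noteq> 0"
        using ne by (simp add: axis_def)
      then show ?case by (metis zero_index)
    qed
  qed (auto intro!: comp borel_measurable_add borel_measurable_diff borel_measurable_times
      borel_measurable_scaleR)
  then show ?thesis
    by (simp add: inner_add_left inner_axis' det3_def)
qed

theorem theorem5p1:
  fixes M :: "'a measure"
    and X :: "nat \<Rightarrow> 'a \<Rightarrow> real^6"
    and \<Sigma> :: "real^6^6"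
  assumes "prob_space M"
    and "\<Sigma> \<in> model_covariances graph_G"
    and "prob_space.indep_vars M (\<lambda>_. borel) X {1..3}"
    and "\<And>k. k \<in> {1..3} \<Longrightarrow> distributed M lborel (X k) (\<lambda>x. ennreal (mvn_density \<Sigma> x))"
  shows "AE \<omega> in M. mle_exists graph_G (sample_cov 3 (\<lambda>k. X k \<omega>))"
proof -
  interpret prob_space M by fact
  \<comment> \<open>Generic position holds for every triple of distinct coordinates; the four
    triples used by the graph argument are instances, and four almost sure events hold
    jointly.\<close>
  note ae = AE_det3_nonzero[OF assms(3,4)]
  have "AE \<omega> in M. det3 (\<lambda>k. X k \<omega>) 1 2 4 \<noteq> 0" "AE \<omega> in M. det3 (\<lambda>k. X k \<omega>) 2 3 6 \<noteq> 0"
    "AE \<omega> in M. det3 (\<lambda>k. X k \<omega>) 2 5 6 \<noteq> 0" "AE \<omega> in M. det3 (\<lambda>k. X k \<omega>) 4 5 6 \<noteq> 0"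
    by (rule ae; simp)+
  then show ?thesis
    by eventually_elim (rule mle_exists_graph_G)
qed

end
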